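(* Let $(G,S)$ be a cube group of rank $n$. For each $s\in S$, let $\langle s\rangle$ denote the subgroup of $G$ generated by $s$. Then there exists an ordering $s_1,\ldots,s_n$ of the set $S$ such that $$G=\langle s_1\rangle\langle s_2\rangle\cdots\langle s_n\rangle.$$ In particular, for any $g\in G$, there exists a unique choice of $m_i\in\{0,1\}$, $i=1,\ldots,n$, such that $$g=s_1^{m_1}s_2^{m_2}\cdots s_n^{m_n}.$$
   Context: Let $G$ be a group and $S\subseteq G$ a subset consisting of involutions (elements of order $2$). The Cayley graph $\mathrm{Cay}(G,S)$ is the undirected graph with vertex set $G$ in which $g,g'$ are joined by an edge if and only if $g'=gs$ for some $s\in S$. The pair $(G,S)$ is a cube group of rank $n$ if $\mathrm{Cay}(G,S)$ is isomorphic, as a graph, to the $1$-skeleton of the $n$-cube (the hypercube graph with vertex set $\{0,1\}^n$, two vertices being adjacent iff they differ in exactly one coordinate). In particular $|S|=n$, $S$ generates $G$, and $|G|=2^n$. The product $\langle s_1\rangle\cdots\langle s_n\rangle$ denotes the set of all products $h_1\cdots h_n$ with $h_i\in\langle s_i\rangle$. *)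

theory Defs
  imports
    "HOL-Algebra.Algebra"
    "Graph_Theory.Pair_Digraph"
    "Graph_Theory.Digraph_Isomorphism"
begin

(* An undirected simple graph is a symmetric digraph: an edge {v, w} is the pair of
   arcs (v, w), (w, v).  The Cayley graph below is symmetric when S consists of
   involutions (cayley_graph_sym). *)

definition cayley_graph :: "('a, 'b) monoid_scheme \<Rightarrow> 'a set \<Rightarrow> 'a pair_pre_digraph" where
  "cayley_graph G S =
     \<lparr>pverts = carrier G,
      parcs = {(g, g'). g \<in> carrier G \<and> g' \<in> carrier G \<and> (\<exists>s\<in>S. g' = g \<otimes>\<^bsub>G\<^esub> s)}\<rparr>"

definition hypercube_graph :: "nat \<Rightarrow> (nat \<Rightarrow> nat) pair_pre_digraph" where
  "hypercube_graph n =
     \<lparr>pverts = {1..n} \<rightarrow>\<^sub>E {0, 1},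
      parcs = {(v, w). v \<in> {1..n} \<rightarrow>\<^sub>E {0, 1} \<and> w \<in> {1..n} \<rightarrow>\<^sub>E {0, 1} \<and>
                       (\<exists>!i. i \<in> {1..n} \<and> v i \<noteq> w i)}\<rparr>"

locale cube_group = group G for G (structure) +
  fixes S :: "'a set" and n :: nat
  assumes generators_closed: "S \<subseteq> carrier G"
    and generators_involutions: "s \<in> S \<Longrightarrow> ord s = 2"
    and cayley_graph_iso_hypercube:
      "digraph_iso (with_proj (cayley_graph G S)) (with_proj (hypercube_graph n))"

definition list_mult :: "('a, 'b) monoid_scheme \<Rightarrow> 'a list \<Rightarrow> 'a" where
  "list_mult G xs = foldr (\<otimes>\<^bsub>G\<^esub>) xs \<one>\<^bsub>G\<^esub>"

definition list_set_mult :: "('a, 'b) monoid_scheme \<Rightarrow> 'a set list \<Rightarrow> 'a set" where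
  "list_set_mult G Hs = {list_mult G hs |hs. hs \<in> listset Hs}"

lemma (in group) cayley_graph_sym:
  assumes "S \<subseteq> carrier G" and "\<And>s. s \<in> S \<Longrightarrow> ord s = 2"
  shows "sym (parcs (cayley_graph G S))"
proof (rule symI)
  fix g g' assume "(g, g') \<in> parcs (cayley_graph G S)"
  then obtain s where s: "g \<in> carrier G" "g' \<in> carrier G" "s \<in> S" "g' = g \<otimes> s"
    by (auto simp: cayley_graph_def)
  have c: "s \<in> carrier G" using s assms by auto
  have "s [^] (2::nat) = \<one>" using pow_ord_eq_1[OF c] assms(2)[OF s(3)] by simp
  hence "s \<otimes> s = \<one>" using c by (simp add: numeral_2_eq_2)
  hence "g = g' \<otimes> s" using s c by (simp add: m_assoc)
  thus "(g', g) \<in> parcs (cayley_graph G S)" using s by (auto simp: cayley_graph_def)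
qed

lemma digraph_iso_pair_iff:
  assumes "pair_wf_digraph H" "pair_wf_digraph K"
  shows "digraph_iso (with_proj H) (with_proj K) \<longleftrightarrow>
    (\<exists>f. bij_betw f (pverts H) (pverts K) \<and>
         (\<forall>u\<in>pverts H. \<forall>v\<in>pverts H. (u, v) \<in> parcs H \<longleftrightarrow> (f u, f v) \<in> parcs K))"
    (is "?L \<longleftrightarrow> ?R")
proof
  interpret H: pair_wf_digraph H by fact
  interpret K: pair_wf_digraph K by fact
  {
    assume ?L
    then obtain h where h: "H.digraph_isomorphism h" and K: "with_proj K = app_iso h (with_proj H)"
      by (auto simp: digraph_iso_def)
    define f where "f = iso_verts h"
    have inj: "inj_on f (pverts H)"
      using h by (auto simp: H.digraph_isomorphism_def f_def)
    have V: "pverts K = f ` pverts H"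
      using arg_cong[OF K, of verts] by (simp add: f_def)
    have A: "parcs K = iso_arcs h ` parcs H"
      using arg_cong[OF K, of arcs] by simp
    have t: "iso_tail h = fst" "iso_head h = snd"
      using arg_cong[OF K, of tail] arg_cong[OF K, of head] by simp_all
    have a: "iso_arcs h e = (f (fst e), f (snd e))" if "e \<in> parcs H" for e
      using h that t by (auto simp: H.digraph_isomorphism_def f_def prod_eq_iff)
    have "(u, v) \<in> parcs H \<longleftrightarrow> (f u, f v) \<in> parcs K"
      if uv: "u \<in> pverts H" "v \<in> pverts H" for u v
    proof
      assume "(u, v) \<in> parcs H"
      thus "(f u, f v) \<in> parcs K" using a A by force
    next
      assume "(f u, f v) \<in> parcs K"
      then obtain e where e: "e \<in> parcs H" "(f u, f v) = (f (fst e), f (snd e))"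
        using A a by auto
      have "fst e \<in> pverts H" "snd e \<in> pverts H"
        using e(1) H.in_arcsD1[of "fst e" "snd e"] H.in_arcsD2[of "fst e" "snd e"] by auto
      hence "u = fst e" "v = snd e" using e uv inj by (auto dest: inj_onD)
      thus "(u, v) \<in> parcs H" using e by simp
    qed
    thus ?R using inj V by (auto simp: bij_betw_def)
  }
  {
    assume ?R
    then obtain f where f: "bij_betw f (pverts H) (pverts K)"
      "\<And>u v. u \<in> pverts H \<Longrightarrow> v \<in> pverts H \<Longrightarrow> (u, v) \<in> parcs H \<longleftrightarrow> (f u, f v) \<in> parcs K"
      by blast
    have inj: "inj_on f (pverts H)" and V: "f ` pverts H = pverts K"
      using f(1) by (auto simp: bij_betw_def)
    define h where
      "h = \<lparr>iso_verts = f, iso_arcs = map_prod f f, iso_head = snd, iso_tail = fst\<rparr>"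
    have XA: "fst e \<in> pverts H \<and> snd e \<in> pverts H" if "e \<in> parcs H" for e
      using that H.in_arcsD1[of "fst e" "snd e"] H.in_arcsD2[of "fst e" "snd e"] by auto
    have YA: "fst e \<in> pverts K \<and> snd e \<in> pverts K" if "e \<in> parcs K" for e
      using that K.in_arcsD1[of "fst e" "snd e"] K.in_arcsD2[of "fst e" "snd e"] by auto
    have "inj_on (map_prod f f) (parcs H)"
      using XA inj by (auto simp: inj_on_def prod_eq_iff)
    hence h: "H.digraph_isomorphism h"
      unfolding H.digraph_isomorphism_def
      using inj H.wf_digraph by (auto simp: h_def)
    have "map_prod f f ` parcs H = parcs K"
    proof (intro equalityI subsetI)
      fix e assume "e \<in> map_prod f f ` parcs H"
      thus "e \<in> parcs K" using XA f(2) by fastforce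
    next
      fix e assume e: "e \<in> parcs K"
      then obtain u v where uv: "u \<in> pverts H" "v \<in> pverts H" "fst e = f u" "snd e = f v"
        using YA V by (metis imageE)
      hence "e = map_prod f f (u, v)" by (simp add: prod_eq_iff)
      moreover have "(u, v) \<in> parcs H" using uv e f(2) by (metis prod.collapse)
      ultimately show "e \<in> map_prod f f ` parcs H" by blast
    qed
    hence "with_proj K = app_iso h (with_proj H)"
      using V by (simp add: app_iso_def h_def with_proj_def)
    thus ?L using h by (auto simp: digraph_iso_def)
  }
qed

end

theory Submission
  imports Defs
begin

text \<open>
  Left translations of \<open>G\<close> are automorphisms of the cube, so they preserve parallelism of edges and
  \<open>G\<close> acts on the set \<open>S\<close> of edge directions. Call \<open>T \<subseteq> S\<close> stable if the elements lying on the
  face spanned by \<open>T\<close> at \<open>\<one>\<close> map \<open>T\<close> to itself; these elements then form a 2-group generated by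
  \<open>T\<close>. Since \<open>s\<close> fixes its own direction, this 2-group is generated by elements with fixed points,
  and a 2-group acting transitively on more than one point is not: a maximal subgroup containing a
  point stabiliser is normal, so it contains every element that has a fixed point. Hence \<open>T\<close> splits
  into two invariant parts, the face is the product of the corresponding two faces, and one
  recurses down to single directions. Uniqueness is a count: there are \<open>2^n\<close> exponent vectors and
  \<open>2^n\<close> group elements.
\<close>

section \<open>Actions of p-groups\<close>

text \<open>Members of \<open>Bij E\<close> are \<open>undefined\<close> off \<open>E\<close>, while
  the maps used below are arbitrary off \<open>E\<close>; hence the restriction. Bijectivity comes
  from \<open>inv g\<close> acting as the inverse of \<open>g\<close>.\<close>

lemma (in group) restrict_group_action:
  assumes closed: "\<And>g x. g \<in> carrier G \<Longrightarrow> x \<in> E \<Longrightarrow> \<phi> g x \<in> E"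
    and one: "\<And>x. x \<in> E \<Longrightarrow> \<phi> \<one> x = x"
    and mult: "\<And>g h x. g \<in> carrier G \<Longrightarrow> h \<in> carrier G \<Longrightarrow> x \<in> E \<Longrightarrow> \<phi> (g \<otimes> h) x = \<phi> g (\<phi> h x)"
  shows "group_action G E (\<lambda>g. \<lambda>x\<in>E. \<phi> g x)"
proof -
  have bij: "(\<lambda>x\<in>E. \<phi> g x) \<in> Bij E" if g: "g \<in> carrier G" for g
  proof -
    have "\<phi> (inv g) (\<phi> g x) = x" "\<phi> g (\<phi> (inv g) x) = x" if "x \<in> E" for x
      using mult[of "inv g" g x] mult[of g "inv g" x] one that g by simp_all
    hence "bij_betw (\<phi> g) E E"
      using closed g by (intro bij_betw_byWitness[where f' = "\<phi> (inv g)"]) auto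
    thus ?thesis by (simp add: Bij_def bij_betw_def)
  qed
  have "(\<lambda>g. \<lambda>x\<in>E. \<phi> g x) \<in> hom G (BijGroup E)"
    using bij closed mult by (auto simp: hom_def BijGroup_def compose_def fun_eq_iff)
  thus ?thesis
    by (simp add: group_action_def group_hom_def group_hom_axioms_def group_BijGroup is_group)
qed

text \<open>By orbit-stabiliser a non-trivial orbit has size a power of \<open>p\<close> other than
  1, so modulo \<open>p\<close> only the fixed points count.\<close>

lemma (in group) p_group_card_fixed_points_cong:
  assumes "Factorial_Ring.prime p" "order G = p ^ k" "finite E"
    and closed: "\<And>g x. g \<in> carrier G \<Longrightarrow> x \<in> E \<Longrightarrow> \<phi> g x \<in> E"
    and one: "\<And>x. x \<in> E \<Longrightarrow> \<phi> \<one> x = x"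
    and mult: "\<And>g h x. g \<in> carrier G \<Longrightarrow> h \<in> carrier G \<Longrightarrow> x \<in> E \<Longrightarrow> \<phi> (g \<otimes> h) x = \<phi> g (\<phi> h x)"
  shows "card E mod p = card {x \<in> E. \<forall>g\<in>carrier G. \<phi> g x = x} mod p"
proof -
  define \<psi> where "\<psi> = (\<lambda>g. \<lambda>x\<in>E. \<phi> g x)"
  interpret group_action G E \<psi>
    unfolding \<psi>_def by (rule restrict_group_action) (use closed one mult in auto)
  define F where "F = {x \<in> E. \<forall>g\<in>carrier G. \<phi> g x = x}"
  have orbE: "orb \<subseteq> E" if "orb \<in> orbits G E \<psi>" for orb
    using that orbits_coverture by blast
  have fin: "finite (orbits G E \<psi>)"
    using orbits_coverture \<open>finite E\<close> by (metis finite_UnionD)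
  \<comment> \<open>Both cardinalities become sums over \<open>E\<close>, of 1 and of the indicator
    of \<open>F\<close>, to be compared one orbit at a time.\<close>
  have "(\<Sum>x\<in>orb. (1::nat)) mod p = (\<Sum>x\<in>orb. if x \<in> F then 1 else 0) mod p"
    if orb: "orb \<in> orbits G E \<psi>" for orb
  proof -
    obtain x where x: "x \<in> E" "orb = orbit G \<psi> x"
      using orb by (auto simp: orbits_def)
    have xo: "x \<in> orb" using orbit_refl x by simp
    show ?thesis
    proof (cases "x \<in> F")
      case True
      hence "orb = {x}"
        using x xo by (auto simp: orbit_def F_def \<psi>_def)
      thus ?thesis using True by simp
    next
      case False
      have noF: "y \<notin> F" if "y \<in> orb" for y
      proof
        assume "y \<in> F"
        moreover have "x \<in> orbit G \<psi> y"
          using orbit_sym[of x y] that orbE[OF orb] x by auto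
        ultimately have "x = y" by (auto simp: orbit_def F_def \<psi>_def)
        thus False using False \<open>y \<in> F\<close> by simp
      qed
      obtain g where g: "g \<in> carrier G" "\<phi> g x \<noteq> x"
        using False x by (auto simp: F_def)
      have "\<phi> g x \<in> orb"
        using g x by (auto simp: orbit_def \<psi>_def)
      have "finite orb" using orbE[OF orb] \<open>finite E\<close> finite_subset by blast
      have ne: "card orb \<noteq> 1"
        using xo \<open>\<phi> g x \<in> orb\<close> g(2) by (auto simp: card_1_singleton_iff)
      have "card orb dvd p ^ k"
        using orbit_stabilizer_theorem[OF x(1)] x(2) assms(2) by (metis dvd_triv_left)
      then obtain j where "card orb = p ^ j"
        using divides_primepow_nat[OF \<open>Factorial_Ring.prime p\<close>] by blast
      hence "p dvd card orb" using ne by (cases j) auto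
      thus ?thesis using noF by simp
    qed
  qed
  hence "(\<Sum>orb\<in>orbits G E \<psi>. \<Sum>x\<in>orb. (1::nat)) mod p =
      (\<Sum>orb\<in>orbits G E \<psi>. \<Sum>x\<in>orb. if x \<in> F then 1 else 0) mod p"
    by (subst (1 2) mod_sum_eq[symmetric]) (simp cong: sum.cong)
  hence "(\<Sum>x\<in>E. (1::nat)) mod p = (\<Sum>x\<in>E. if x \<in> F then 1 else 0) mod p"
    by (simp only: disjoint_sum[OF \<open>finite E\<close>])
  moreover have "(\<Sum>x\<in>E. if x \<in> F then 1 else 0) = card F"
    using card_as_sums[of F E "\<lambda>x. x \<in> F"] \<open>finite E\<close> by (auto simp: F_def)
  ultimately show ?thesis by (simp add: F_def)
qed

text \<open>\<open>M\<close> acts on its right cosets with the fixed point \<open>M\<close>; as \<open>p\<close> divides the index there is another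
  fixed point \<open>M #> x\<close>.\<close>

lemma (in group) p_group_normalizer_grows:
  assumes "Factorial_Ring.prime p" "order G = p ^ k" "subgroup M G" "M \<noteq> carrier G"
  shows "\<exists>x\<in>carrier G - M. \<forall>m\<in>M. x \<otimes> m \<otimes> inv x \<in> M"
proof -
  interpret M: subgroup M G by fact
  have "order G > 0" using assms prime_gt_0_nat by auto
  hence fin: "finite (carrier G)" by (simp add: order_def card_gt_0_iff)
  have lag: "card (rcosets M) * card M = p ^ k"
    using lagrange[OF \<open>subgroup M G\<close>] assms by simp
  obtain j where j: "card M = p ^ j"
    using divides_primepow_nat[OF \<open>Factorial_Ring.prime p\<close>] lag by (metis dvd_triv_right)
  obtain i where i: "card (rcosets M) = p ^ i"
    using divides_primepow_nat[OF \<open>Factorial_Ring.prime p\<close>] lag by (metis dvd_triv_left)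
  have "card M \<noteq> card (carrier G)"
    using card_subset_eq[OF fin M.subset] assms by blast
  hence "i \<noteq> 0"
    using i lag assms by (auto simp: order_def)
  interpret GM: group "G\<lparr>carrier := M\<rparr>"
    by (rule subgroup_imp_group) fact
  have Mr: "M #> \<one> = M" using M.subset by (simp add: coset_mult_one)
  have sub: "C \<subseteq> carrier G" if "C \<in> rcosets M" for C
    using that M.rcosets_carrier[OF is_group] by blast
  have finR: "finite (rcosets M)"
    using i \<open>Factorial_Ring.prime p\<close> prime_gt_0_nat by (metis card.infinite power_not_zero neq0_conv)
  \<comment> \<open>Right multiplication by \<open>inv g\<close> instead of \<open>g\<close> makes
    this a left action on right cosets.\<close>
  have "card (rcosets M) mod p =
      card {C \<in> rcosets M. \<forall>g\<in>carrier (G\<lparr>carrier := M\<rparr>). C #> inv g = C} mod p"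
  proof (rule GM.p_group_card_fixed_points_cong[where k = j])
    show "C #> inv g \<in> rcosets M" if g: "g \<in> carrier (G\<lparr>carrier := M\<rparr>)" and C: "C \<in> rcosets M" for g C
    proof -
      obtain x where "x \<in> carrier G" "C = M #> x" using C by (auto simp: RCOSETS_def)
      thus ?thesis using g M.subset by (auto simp: coset_mult_assoc intro!: rcosetsI)
    qed
    show "C #> inv \<one>\<^bsub>G\<lparr>carrier := M\<rparr>\<^esub> = C" if "C \<in> rcosets M" for C
      using sub[OF that] by (simp add: coset_mult_one)
    show "C #> inv (g \<otimes>\<^bsub>G\<lparr>carrier := M\<rparr>\<^esub> h) = C #> inv h #> inv g"
      if "g \<in> carrier (G\<lparr>carrier := M\<rparr>)" "h \<in> carrier (G\<lparr>carrier := M\<rparr>)" "C \<in> rcosets M" for g h C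
      using that sub[OF that(3)] M.subset by (auto simp: coset_mult_assoc inv_mult_group)
  qed (use assms j finR in \<open>auto simp: order_def\<close>)
  hence dv: "p dvd card {C \<in> rcosets M. \<forall>g\<in>M. C #> inv g = C}" (is "_ dvd card ?F")
    using i \<open>i \<noteq> 0\<close> by (simp add: mod_0_imp_dvd)
  have "M \<in> ?F"
    using rcosetsI[OF M.subset one_closed] Mr M.m_inv_closed
    by (auto simp: coset_join2 \<open>subgroup M G\<close> M.mem_carrier)
  moreover have "?F \<noteq> {M}" using dv \<open>Factorial_Ring.prime p\<close> by auto
  ultimately obtain C where C: "C \<in> ?F" "C \<noteq> M" by blast
  then obtain x where x: "x \<in> carrier G" "C = M #> x" by (auto simp: RCOSETS_def)
  have "x \<notin> M" using C x coset_join2[OF x(1) \<open>subgroup M G\<close>] by auto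
  moreover have "x \<otimes> m \<otimes> inv x \<in> M" if m: "m \<in> M" for m
  proof -
    have mc: "m \<in> carrier G" using m by (rule M.mem_carrier)
    have "M #> x #> m = M #> x"
    proof -
      have "C #> inv (inv m) = C" using C(1) M.m_inv_closed[OF m] by blast
      thus ?thesis using x mc by simp
    qed
    hence "x \<otimes> m \<in> M #> x"
      using rcos_self[OF _ \<open>subgroup M G\<close>, of "x \<otimes> m"] x mc M.subset by (simp add: coset_mult_assoc)
    then obtain m' where "m' \<in> M" "x \<otimes> m = m' \<otimes> x" by (auto simp: r_coset_def)
    thus ?thesis using x mc M.mem_carrier[of m'] by (simp add: m_assoc)
  qed
  ultimately show ?thesis using x by blast
qed

text \<open>The normalizer of \<open>M\<close> is strictly larger than \<open>M\<close>, so
  maximality leaves only the whole group.\<close>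

lemma (in group) p_group_maximal_subgroup_normal:
  assumes "Factorial_Ring.prime p" "order G = p ^ k" "subgroup M G" "M \<noteq> carrier G"
    and max: "\<And>N. subgroup N G \<Longrightarrow> M \<subseteq> N \<Longrightarrow> N = M \<or> N = carrier G"
  shows "M \<lhd> G"
proof -
  interpret M: subgroup M G by fact
  have "order G > 0" using assms prime_gt_0_nat by auto
  hence "finite (carrier G)" by (simp add: order_def card_gt_0_iff)
  hence finM: "finite M" using M.subset finite_subset by blast
  \<comment> \<open>One inclusion already defines the normalizer: \<open>M\<close> is finite, so a
    conjugation of \<open>M\<close> into itself is onto, which gives closure under inverses.\<close>
  define N where "N = {x \<in> carrier G. \<forall>m\<in>M. x \<otimes> m \<otimes> inv x \<in> M}"
  have Ninv: "inv x \<in> N" if x: "x \<in> N" for x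
  proof -
    have xc: "x \<in> carrier G" using x by (simp add: N_def)
    have "inj_on (\<lambda>m. x \<otimes> m \<otimes> inv x) M"
      using xc M.subset by (auto simp: inj_on_def)
    hence "(\<lambda>m. x \<otimes> m \<otimes> inv x) ` M = M"
      using x finM by (intro endo_inj_surj) (auto simp: N_def)
    hence "\<exists>m'\<in>M. m = x \<otimes> m' \<otimes> inv x" if "m \<in> M" for m using that by blast
    moreover have "inv x \<otimes> (x \<otimes> m' \<otimes> inv x) \<otimes> x = m'" if "m' \<in> M" for m'
      using conjugation_is_surj[of "inv x" m'] that xc M.mem_carrier by simp
    ultimately have "inv x \<otimes> m \<otimes> x \<in> M" if "m \<in> M" for m
      using that by metis
    thus ?thesis using xc by (simp add: N_def)
  qed
  have "subgroup N G"
  proof (rule subgroupI)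
    show "N \<noteq> {}" by (auto simp: N_def intro!: exI[of _ \<one>])
    show "x \<otimes> y \<in> N" if "x \<in> N" "y \<in> N" for x y
    proof -
      have c: "x \<in> carrier G" "y \<in> carrier G" using that by (auto simp: N_def)
      have "x \<otimes> y \<otimes> m \<otimes> inv (x \<otimes> y) = x \<otimes> (y \<otimes> m \<otimes> inv y) \<otimes> inv x" if "m \<in> M" for m
        using c that by (simp add: m_assoc inv_mult_group)
      thus ?thesis using that c by (auto simp: N_def)
    qed
  qed (use Ninv in \<open>auto simp: N_def\<close>)
  moreover have "M \<subseteq> N" by (auto simp: N_def)
  moreover have "N \<noteq> M"
    using p_group_normalizer_grows[OF assms(1-4)] by (auto simp: N_def)
  ultimately have "N = carrier G" using max by blast
  thus ?thesis using \<open>subgroup M G\<close> by (auto simp: normal_inv_iff N_def)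
qed

text \<open>Otherwise the stabiliser \<open>K\<close> of \<open>x\<close> is proper and lies in a
  maximal subgroup \<open>M\<close>, which is normal. By transitivity every element with a fixed
  point is conjugate to a member of \<open>K\<close>, so all of \<open>A\<close> lies in
  \<open>M\<close>.\<close>

lemma (in group) p_group_transitive_action_trivial:
  assumes "Factorial_Ring.prime p" "order G = p ^ k"
    and closed: "\<And>g x. g \<in> carrier G \<Longrightarrow> x \<in> E \<Longrightarrow> \<phi> g x \<in> E"
    and one: "\<And>x. x \<in> E \<Longrightarrow> \<phi> \<one> x = x"
    and mult: "\<And>g h x. g \<in> carrier G \<Longrightarrow> h \<in> carrier G \<Longrightarrow> x \<in> E \<Longrightarrow> \<phi> (g \<otimes> h) x = \<phi> g (\<phi> h x)"
    and trans: "\<And>x y. x \<in> E \<Longrightarrow> y \<in> E \<Longrightarrow> \<exists>g\<in>carrier G. \<phi> g x = y"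
    and A: "A \<subseteq> carrier G"
    and gen: "\<And>H. subgroup H G \<Longrightarrow> A \<subseteq> H \<Longrightarrow> H = carrier G"
    and fixed: "\<And>a. a \<in> A \<Longrightarrow> \<exists>x\<in>E. \<phi> a x = x"
    and xy: "x \<in> E" "y \<in> E"
  shows "x = y"
proof (rule ccontr)
  assume "x \<noteq> y"
  interpret group_action G E "\<lambda>g. \<lambda>x\<in>E. \<phi> g x"
    by (rule restrict_group_action) (use closed one mult in auto)
  define K where "K = {g \<in> carrier G. \<phi> g x = x}"
  have "subgroup K G"
    using stabilizer_subgroup[OF xy(1)] xy(1) by (simp add: stabilizer_def K_def)
  moreover have "K \<noteq> carrier G"
  proof -
    obtain g where "g \<in> carrier G" "\<phi> g x = y" using trans[OF xy] by blast
    hence "g \<in> carrier G - K" using \<open>x \<noteq> y\<close> by (simp add: K_def)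
    thus ?thesis by blast
  qed
  ultimately have Kin: "K \<in> {H. subgroup H G \<and> H \<noteq> carrier G}" by simp
  have "order G > 0" using assms prime_gt_0_nat by auto
  hence fin: "finite (carrier G)" by (simp add: order_def card_gt_0_iff)
  have "finite {H. subgroup H G \<and> H \<noteq> carrier G}"
    by (rule finite_subset[of _ "Pow (carrier G)"]) (use fin in \<open>auto dest: subgroup.subset\<close>)
  then obtain M where M: "K \<subseteq> M" "subgroup M G" "M \<noteq> carrier G"
    and max: "\<And>N. subgroup N G \<Longrightarrow> N \<noteq> carrier G \<Longrightarrow> M \<subseteq> N \<Longrightarrow> M = N"
    using finite_has_maximal2[OF _ Kin] by auto
  have "M \<lhd> G"
    using p_group_maximal_subgroup_normal[OF assms(1,2) M(2,3)] max by blast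
  have "A \<subseteq> M"
  proof
    fix a assume a: "a \<in> A"
    hence ac: "a \<in> carrier G" using A by auto
    obtain u where u: "u \<in> E" "\<phi> a u = u" using fixed[OF a] by blast
    obtain g where g: "g \<in> carrier G" "\<phi> g x = u" using trans[OF xy(1) u(1)] by blast
    have "\<phi> (inv g) u = x"
      using mult[of "inv g" g x] g xy one by simp
    hence "\<phi> (inv g \<otimes> a \<otimes> g) x = x"
      using g u ac xy by (simp add: mult)
    hence "inv g \<otimes> a \<otimes> g \<in> M" using M(1) g ac by (auto simp: K_def)
    hence "g \<otimes> (inv g \<otimes> a \<otimes> g) \<otimes> inv g \<in> M"
      using \<open>M \<lhd> G\<close> g(1) by (auto simp: normal_inv_iff)
    thus "a \<in> M" using conjugation_is_surj[OF g(1) ac] by simp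
  qed
  thus False using gen M by blast
qed

section \<open>Edge directions in a cube group\<close>

text \<open>\<open>f g\<close> is the set of coordinates in which \<open>g\<close> differs from \<open>\<one>\<close>, where the coordinate directions
  are named by the edges at \<open>\<one>\<close>, and \<open>p g s\<close> is the direction of the edge from \<open>g\<close> to \<open>g \<otimes> s\<close>.\<close>

locale cube_labelling = group G for G (structure) +
  fixes S :: "'a set" and f :: "'a \<Rightarrow> 'a set" and p :: "'a \<Rightarrow> 'a \<Rightarrow> 'a"
  assumes S_subset: "S \<subseteq> carrier G"
    and finite_S: "finite S"
    and involution: "s \<in> S \<Longrightarrow> s \<otimes> s = \<one>"
    and f_bij: "bij_betw f (carrier G) (Pow S)"
    and f_one: "f \<one> = {}"
    and p_bij: "g \<in> carrier G \<Longrightarrow> bij_betw (p g) S S"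
    and p_one: "s \<in> S \<Longrightarrow> p \<one> s = s"
    and f_step: "g \<in> carrier G \<Longrightarrow> s \<in> S \<Longrightarrow> f (g \<otimes> s) = sym_diff (f g) {p g s}"
begin

lemma S_carrier: "s \<in> S \<Longrightarrow> s \<in> carrier G"
  using S_subset by blast

lemma p_closed: "g \<in> carrier G \<Longrightarrow> s \<in> S \<Longrightarrow> p g s \<in> S"
  using p_bij by (auto simp: bij_betw_def)

lemma p_inj: "g \<in> carrier G \<Longrightarrow> s \<in> S \<Longrightarrow> t \<in> S \<Longrightarrow> p g s = p g t \<longleftrightarrow> s = t"
  using p_bij by (auto simp: bij_betw_def dest: inj_onD)

lemma p_surj: "g \<in> carrier G \<Longrightarrow> t \<in> S \<Longrightarrow> \<exists>s\<in>S. p g s = t"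
  using bij_betw_imp_surj_on[OF p_bij] by (metis imageE)

lemma f_subset: "g \<in> carrier G \<Longrightarrow> f g \<subseteq> S"
  using f_bij by (auto simp: bij_betw_def)

lemma f_inj: "g \<in> carrier G \<Longrightarrow> h \<in> carrier G \<Longrightarrow> f g = f h \<Longrightarrow> g = h"
  using f_bij by (auto simp: bij_betw_def dest: inj_onD)

lemma f_surj: "Y \<subseteq> S \<Longrightarrow> \<exists>g\<in>carrier G. f g = Y"
  using bij_betw_imp_surj_on[OF f_bij] by (metis PowI imageE)

lemma f_generator: "s \<in> S \<Longrightarrow> f s = {s}"
  using f_step[of \<one> s] by (simp add: f_one p_one S_carrier)

lemma step_back: "g \<in> carrier G \<Longrightarrow> s \<in> S \<Longrightarrow> g \<otimes> s \<otimes> s = g"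
  by (simp add: m_assoc involution S_carrier)

text \<open>Crossing an edge and returning restores \<open>f g\<close>, and two flips cancel only if
  they flip the same coordinate.\<close>

lemma p_step_same:
  assumes "g \<in> carrier G" "s \<in> S"
  shows "p (g \<otimes> s) s = p g s"
proof -
  have "f g = sym_diff (sym_diff (f g) {p g s}) {p (g \<otimes> s) s}"
    using f_step[of "g \<otimes> s" s] f_step[of g s] assms step_back[OF assms] by (simp add: S_carrier)
  thus ?thesis by auto
qed

text \<open>A shortest path from \<one> to \<open>g\<close> flips only coordinates in
  \<open>f g\<close>. The conditions recording this in \<open>step\<close> let
  \<open>face_generated\<close> stay inside a face.\<close>

lemma generator_induct [consumes 1, case_names one step]:
  assumes "g \<in> carrier G"
    and one: "P \<one>"
    and step: "\<And>h t. h \<in> carrier G \<Longrightarrow> t \<in> S \<Longrightarrow> f h \<subseteq> f g \<Longrightarrow> p h t \<in> f g \<Longrightarrow> P h \<Longrightarrow> P (h \<otimes> t)"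
  shows "P g"
proof -
  have "k \<in> carrier G \<Longrightarrow> f k \<subseteq> f g \<Longrightarrow> P k" for k
  proof (induction "card (f k)" arbitrary: k rule: less_induct)
    case less
    show ?case
    proof (cases "f k = {}")
      case True
      hence "k = \<one>" using f_inj[of k \<one>] less by (simp add: f_one)
      thus ?thesis using one by simp
    next
      case False
      \<comment> \<open>Undoing one coordinate \<open>x\<close> of \<open>k\<close> gives the
        predecessor \<open>k \<otimes> t\<close> on such a path; a second step along
        \<open>t\<close> returns to \<open>k\<close>.\<close>
      then obtain x where x: "x \<in> f k" by blast
      then obtain t where t: "t \<in> S" "p k t = x"
        using p_surj f_subset less by blast
      have f: "f (k \<otimes> t) = f k - {x}" using f_step[of k t] t less x by auto
      have "finite (f k)" using f_subset[of k] less finite_S finite_subset by blast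
      hence "card (f (k \<otimes> t)) < card (f k)" using f x by (metis card_Diff1_less)
      hence "P (k \<otimes> t)" using less f t S_carrier by blast
      hence "P (k \<otimes> t \<otimes> t)"
        using step[of "k \<otimes> t" t] f t x less p_step_same[of k t] S_carrier by auto
      thus ?thesis using step_back[of k t] t less by simp
    qed
  qed
  thus ?thesis using assms(1) by blast
qed

text \<open>Left translations map squares to squares, and opposite edges of a square are parallel.\<close>

lemma p_mult_step:
  assumes g: "g \<in> carrier G" and h: "h \<in> carrier G" and t: "t \<in> S" and s: "s \<in> S"
    and IH: "\<And>u. u \<in> S \<Longrightarrow> p (g \<otimes> h) u = p g (p h u)"
  shows "p (g \<otimes> (h \<otimes> t)) s = p g (p (h \<otimes> t) s)"
proof (cases "s = t")
  case True
  thus ?thesis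
    using p_step_same[of "g \<otimes> h" t] p_step_same[of h t] g h t IH by (simp add: m_assoc S_carrier)
next
  case False
  have ht: "h \<otimes> t \<in> carrier G" and gh: "g \<otimes> h \<in> carrier G"
    using g h t S_carrier by auto
  \<comment> \<open>\<open>u\<close> is the edge at \<open>h\<close> parallel to the edge along
    \<open>s\<close> at \<open>h \<otimes> t\<close>; together with \<open>v\<close> it closes a
    square.\<close>
  obtain u where u: "u \<in> S" "p h u = p (h \<otimes> t) s"
    using p_surj[OF h p_closed[OF ht s]] by blast
  have "p h u \<noteq> p h t"
    using p_inj[OF ht s t] False p_step_same[OF h t] u by simp
  hence ut: "u \<noteq> t" by blast
  have hu: "h \<otimes> u \<in> carrier G" using h u S_carrier by auto
  obtain v where v: "v \<in> S" "p (h \<otimes> u) v = p h t"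
    using p_surj[OF hu p_closed[OF h t]] by blast
  have "f (h \<otimes> t \<otimes> s) = f (h \<otimes> u \<otimes> v)"
    using f_step[OF ht s] f_step[OF hu v(1)] f_step[OF h t] f_step[OF h u(1)] u v by auto
  hence "h \<otimes> t \<otimes> s = h \<otimes> u \<otimes> v"
    using f_inj ht hu s v S_carrier by blast
  hence eq: "g \<otimes> h \<otimes> t \<otimes> s = g \<otimes> h \<otimes> u \<otimes> v"
    using g h t s u(1) v(1) S_carrier by (simp add: m_assoc)
  have ght: "g \<otimes> h \<otimes> t \<in> carrier G" and ghu: "g \<otimes> h \<otimes> u \<in> carrier G"
    using gh t u S_carrier by auto
  \<comment> \<open>These are the directions in the translated square. Its two paths flip the same
    pair of coordinates, so \<open>{a, b} = {c, d}\<close>, and \<open>a \<noteq> c\<close> forces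
    \<open>b = c\<close>.\<close>
  define a b c d where "a = p (g \<otimes> h) t" and "b = p (g \<otimes> h \<otimes> t) s"
    and "c = p (g \<otimes> h) u" and "d = p (g \<otimes> h \<otimes> u) v"
  have "sym_diff (sym_diff (f (g \<otimes> h)) {a}) {b} = sym_diff (sym_diff (f (g \<otimes> h)) {c}) {d}"
    using eq f_step[OF ght s] f_step[OF ghu v(1)] f_step[OF gh t] f_step[OF gh u(1)]
    by (simp add: a_def b_def c_def d_def)
  moreover have "a \<noteq> c" using p_inj[OF gh t u(1)] ut by (auto simp: a_def c_def)
  moreover have "a \<noteq> b"
    using p_inj[OF ght s t] False p_step_same[OF gh t] by (auto simp: a_def b_def)
  ultimately have "b = c" by blast
  thus ?thesis using IH[OF u(1)] u(2) g h t S_carrier by (simp add: b_def c_def m_assoc)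
qed

lemma p_mult:
  assumes "h \<in> carrier G" "g \<in> carrier G" "s \<in> S"
  shows "p (g \<otimes> h) s = p g (p h s)"
proof -
  have "\<forall>s\<in>S. p (g \<otimes> h) s = p g (p h s)"
    using assms(1) by (induction rule: generator_induct)
      (use assms p_one p_mult_step in auto)
  thus ?thesis using assms by blast
qed

text \<open>Left translation by \<open>g\<close> permutes the coordinates by \<open>p g\<close> and
  then flips those in \<open>f g\<close>. This cocycle rule turns questions about products in
  \<open>G\<close> into questions about subsets of \<open>S\<close>.\<close>

lemma f_mult:
  assumes "h \<in> carrier G" and g: "g \<in> carrier G"
  shows "f (g \<otimes> h) = sym_diff (f g) (p g ` f h)"
  using assms(1)
proof (induction rule: generator_induct)
  case one
  show ?case using g by (simp add: f_one)
next
  case (step h t)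
  have "f (g \<otimes> (h \<otimes> t)) = sym_diff (sym_diff (f g) (p g ` f h)) {p g (p h t)}"
    using f_step[of "g \<otimes> h" t] step g p_mult[of h g t] by (simp add: m_assoc S_carrier)
  also have "\<dots> = sym_diff (f g) (sym_diff (p g ` f h) (p g ` {p h t}))" by auto
  also have "sym_diff (p g ` f h) (p g ` {p h t}) = p g ` f (h \<otimes> t)"
  proof -
    have inj: "inj_on (p g) S" using p_bij[OF g] by (simp add: bij_betw_def)
    have sub: "f h - {p h t} \<subseteq> S" "{p h t} - f h \<subseteq> S" "f h \<subseteq> S" "{p h t} \<subseteq> S"
      using f_subset[of h] p_closed[of h t] step by auto
    show ?thesis
      unfolding f_step[OF step(1,2)] image_Un
        inj_on_image_set_diff[OF inj sub(1,4)] inj_on_image_set_diff[OF inj sub(2,3)] ..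
  qed
  finally show ?case .
qed

section \<open>Faces through the identity and stable sets of directions\<close>

definition face :: "'a set \<Rightarrow> 'a set" where
  "face T = {g \<in> carrier G. f g \<subseteq> T}"

text \<open>Invariance is asked under \<open>face T\<close> only, not under all of \<open>G\<close>:
  a part of \<open>T\<close> invariant under \<open>face T\<close> is then itself stable, since its
  own face is smaller.\<close>

definition stable :: "'a set \<Rightarrow> bool" where
  "stable T \<longleftrightarrow> T \<subseteq> S \<and> (\<forall>g\<in>face T. p g ` T = T)"

lemma face_carrier: "g \<in> face T \<Longrightarrow> g \<in> carrier G"
  by (simp add: face_def)

lemma face_mono: "T \<subseteq> U \<Longrightarrow> face T \<subseteq> face U"
  by (auto simp: face_def)

lemma generator_in_face: "T \<subseteq> S \<Longrightarrow> t \<in> T \<Longrightarrow> t \<in> face T"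
  using f_generator S_carrier by (auto simp: face_def)

lemma stable_subset: "stable T \<Longrightarrow> T \<subseteq> S"
  by (simp add: stable_def)

lemma stable_image: "stable T \<Longrightarrow> g \<in> face T \<Longrightarrow> p g ` T = T"
  by (simp add: stable_def)

lemma p_preimage:
  assumes "g \<in> carrier G" "T \<subseteq> S" "p g ` T = T" "Y \<subseteq> S" "p g ` Y \<subseteq> T"
  shows "Y \<subseteq> T"
proof
  fix x assume x: "x \<in> Y"
  hence "p g x \<in> p g ` T" using assms by blast
  thus "x \<in> T" using p_inj[OF assms(1)] x assms by blast
qed

text \<open>By \<open>f_mult\<close> the coordinates of \<open>g \<otimes> h\<close> lie among those
  of \<open>g\<close> and the images under \<open>p g\<close> of those of \<open>h\<close>, and
  \<open>p g\<close> maps \<open>T\<close> onto itself.\<close>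

lemma face_subgroup:
  assumes T: "stable T"
  shows "subgroup (face T) G"
proof (rule subgroupI)
  show "face T \<subseteq> carrier G" by (auto simp: face_def)
  have "\<one> \<in> face T" by (simp add: face_def f_one)
  thus "face T \<noteq> {}" by blast
  show "inv g \<in> face T" if g: "g \<in> face T" for g
  proof -
    have gc: "g \<in> carrier G" using g by (rule face_carrier)
    have "sym_diff (f g) (p g ` f (inv g)) = {}"
      using f_mult[of "inv g" g] gc f_one by simp
    hence "p g ` f (inv g) \<subseteq> T" using g by (auto simp: face_def)
    hence "f (inv g) \<subseteq> T"
      using p_preimage[OF gc stable_subset[OF T] stable_image[OF T g] f_subset] gc by simp
    thus ?thesis using gc by (simp add: face_def)
  qed
  show "g \<otimes> h \<in> face T" if g: "g \<in> face T" and h: "h \<in> face T" for g h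
  proof -
    have "p g ` f h \<subseteq> T" using stable_image[OF T g] h by (auto simp: face_def)
    thus ?thesis using f_mult[of h g] g h by (auto simp: face_def)
  qed
qed

text \<open>This makes stable faces 2-groups and, for \<open>T = S\<close>, gives the order of
  \<open>G\<close> for the uniqueness count.\<close>

lemma card_face:
  assumes "T \<subseteq> S"
  shows "card (face T) = 2 ^ card T"
proof -
  have "Y \<in> f ` face T" if "Y \<subseteq> T" for Y
    using f_surj[of Y] that assms by (auto simp: face_def)
  hence "f ` face T = Pow T" by (auto simp: face_def)
  moreover have "inj_on f (face T)"
    using f_inj by (auto simp: inj_on_def face_def)
  ultimately have "card (face T) = card (Pow T)" by (metis card_image)
  thus ?thesis using assms finite_S finite_subset card_Pow by metis
qed

text \<open>A shortest path from \<one> to a point of the face stays in the face. Its steps are by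
  members of \<open>T\<close>, since \<open>p h\<close> maps \<open>T\<close> onto itself and is
  injective on \<open>S\<close>.\<close>

lemma face_generated:
  assumes T: "stable T" and H: "subgroup H G" "T \<subseteq> H"
  shows "face T \<subseteq> H"
proof
  fix g assume g: "g \<in> face T"
  hence "g \<in> carrier G" by (rule face_carrier)
  thus "g \<in> H"
  proof (induction rule: generator_induct)
    case one
    show ?case using H by (simp add: subgroup.one_closed)
  next
    case (step h t)
    have hT: "h \<in> face T" using step g by (auto simp: face_def)
    have "p h t \<in> p h ` T"
      using stable_image[OF T hT] step g by (auto simp: face_def)
    hence "t \<in> T" using p_inj[of h] step stable_subset[OF T] by blast
    hence "t \<in> H" using H(2) by blast
    moreover have "h \<in> H" using step by blast
    ultimately show ?case using subgroup.m_closed[OF H(1)] by simp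
  qed
qed

text \<open>Each \<open>t \<in> T\<close> fixes the point \<open>t\<close>, so these generators of the 2-group \<open>face T\<close> cannot act
  transitively on \<open>T\<close> unless \<open>T\<close> is a single point.\<close>

lemma stable_split:
  assumes T: "stable T" and xy: "x \<in> T" "y \<in> T" "x \<noteq> y"
  shows "\<exists>A. A \<subset> T \<and> A \<noteq> {} \<and> (\<forall>g\<in>face T. p g ` A = A)"
proof -
  define H where "H = G\<lparr>carrier := face T\<rparr>"
  note subT = stable_subset[OF T]
  interpret H: group H
    unfolding H_def using subgroup_imp_group[OF face_subgroup[OF T]] .
  have "\<exists>x\<in>T. \<exists>y\<in>T. \<forall>g\<in>face T. p g x \<noteq> y"
  proof (rule ccontr)
    assume *: "\<not> ?thesis"
    have "x = y"
    proof (rule H.p_group_transitive_action_trivial[where A = T and \<phi> = p and E = T and p = 2])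
      show "K = carrier H" if "subgroup K H" "T \<subseteq> K" for K
        using that face_generated[OF T, of K] incl_subgroup[OF face_subgroup[OF T], of K]
          subgroup.subset[OF that(1)] by (auto simp: H_def)
      show "T \<subseteq> carrier H" using generator_in_face[OF subT] by (auto simp: H_def)
      show "order H = 2 ^ card T" by (simp add: order_def H_def card_face[OF subT])
      show "\<exists>x\<in>T. p a x = x" if "a \<in> T" for a
        using p_step_same[of \<one> a] that subT p_one[of a] S_carrier[of a] by (intro bexI[of _ a]) auto
      show "\<exists>g\<in>carrier H. p g x = y" if "x \<in> T" "y \<in> T" for x y
        using * that by (auto simp: H_def)
      show "p g x \<in> T" if "g \<in> carrier H" "x \<in> T" for g x
        using that stable_image[OF T, of g] by (auto simp: H_def)
    qed (use xy subT p_mult face_carrier p_one in \<open>auto simp: H_def\<close>)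
    thus False using xy by blast
  qed
  then obtain a b where ab: "a \<in> T" "b \<in> T" "\<And>g. g \<in> face T \<Longrightarrow> p g a \<noteq> b" by blast
  \<comment> \<open>\<open>A\<close> is the orbit of \<open>a\<close>; it misses \<open>b\<close>
    and is therefore proper.\<close>
  define A where "A = (\<lambda>g. p g a) ` face T"
  have AT: "A \<subseteq> T" using ab stable_image[OF T] by (auto simp: A_def)
  have "p g ` A = A" if g: "g \<in> face T" for g
  proof (rule endo_inj_surj)
    show "finite A" using AT subT finite_S finite_subset by metis
    show "inj_on (p g) A" using p_inj[of g] face_carrier[OF g] AT subT by (auto simp: inj_on_def)
    have "p g (p h a) = p (g \<otimes> h) a \<and> g \<otimes> h \<in> face T" if "h \<in> face T" for h
      using p_mult[of h g a] that g ab subT face_carrier subgroup.m_closed[OF face_subgroup[OF T]] by auto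
    thus "p g ` A \<subseteq> A" by (auto simp: A_def)
  qed
  moreover have "b \<notin> A" using ab by (auto simp: A_def)
  moreover have "\<one> \<in> face T" by (simp add: face_def f_one)
  hence "A \<noteq> {}" by (auto simp: A_def)
  ultimately show ?thesis using AT ab by blast
qed

section \<open>Factorisation of faces and ordered products\<close>

lemma face_factor:
  assumes "g \<in> carrier G" "f g \<subseteq> A \<union> B" "A \<inter> B = {}" "A \<subseteq> S" "B \<subseteq> S"
    and B: "\<And>h. h \<in> face A \<Longrightarrow> p h ` B = B"
  shows "\<exists>h\<in>face A. \<exists>k\<in>face B. g = h \<otimes> k"
proof -
  \<comment> \<open>\<open>h\<close> is the projection of \<open>g\<close> to the face of
    \<open>A\<close>; the cofactor \<open>inv h \<otimes> g\<close> should then lie in the face of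
    \<open>B\<close>.\<close>
  obtain h where h: "h \<in> carrier G" "f h = f g \<inter> A"
    using f_surj[of "f g \<inter> A"] assms by blast
  hence hA: "h \<in> face A" by (simp add: face_def)
  define k where "k = inv h \<otimes> g"
  have k: "k \<in> carrier G" "g = h \<otimes> k"
    using h assms by (auto simp: k_def m_assoc[symmetric])
  \<comment> \<open>The image of \<open>f k\<close> under \<open>p h\<close> is the part of
    \<open>f g\<close> outside \<open>A\<close>, hence inside \<open>B\<close>; invariance of
    \<open>B\<close> pulls this back to \<open>f k\<close>.\<close>
  have "f g = sym_diff (f g \<inter> A) (p h ` f k)"
    using f_mult[OF k(1) h(1)] k h by simp
  hence "p h ` f k \<subseteq> B" using assms(2,3) by blast
  hence "f k \<subseteq> B"
    using p_preimage[OF h(1) assms(5) B[OF hA] f_subset] k by simp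
  thus ?thesis using hA k by (auto simp: face_def)
qed

lemma list_mult_append:
  assumes "set xs \<subseteq> carrier G" "set ys \<subseteq> carrier G"
  shows "list_mult G (xs @ ys) = list_mult G xs \<otimes> list_mult G ys"
    and "list_mult G xs \<in> carrier G"
proof -
  have c: "list_mult G zs \<in> carrier G" if "set zs \<subseteq> carrier G" for zs
    using that by (induction zs) (auto simp: list_mult_def)
  show "list_mult G xs \<in> carrier G" using c assms by blast
  show "list_mult G (xs @ ys) = list_mult G xs \<otimes> list_mult G ys"
    using assms(1)
  proof (induction xs)
    case Nil
    show ?case using c[OF assms(2)] by (simp add: list_mult_def)
  next
    case (Cons x xs)
    thus ?case using c[OF assms(2)] c[of xs] by (simp add: list_mult_def m_assoc)
  qed
qed

text \<open>One ordering \<open>xs\<close> serves every \<open>g\<close>: it concatenates the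
  orderings of the two parts of \<open>T\<close>. Exponents are functions of the generator, not of
  its position, so those of the two parts can be merged.\<close>

lemma face_eq_product:
  assumes "stable T"
  shows "\<exists>xs. distinct xs \<and> set xs = T \<and>
    (\<forall>g\<in>face T. \<exists>m. range m \<subseteq> {0, 1::nat} \<and> g = list_mult G (map (\<lambda>s. s [^] m s) xs))"
  using assms
proof (induction "card T" arbitrary: T rule: less_induct)
  case less
  note T = less.prems
  note subT = stable_subset[OF T]
  have finT: "finite T" using subT finite_S finite_subset by blast
  show ?case
  proof (cases "\<exists>x\<in>T. \<exists>y\<in>T. x \<noteq> y")
    case True
    then obtain x y where "x \<in> T" "y \<in> T" "x \<noteq> y" by blast
    from stable_split[OF T this]
    obtain A where A: "A \<subset> T" "A \<noteq> {}" "\<And>g. g \<in> face T \<Longrightarrow> p g ` A = A" by blast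
    define B where "B = T - A"
    have B: "B \<subset> T" "A \<union> B = T" "A \<inter> B = {}" using A by (auto simp: B_def)
    have pB: "p g ` B = B" if g: "g \<in> face T" for g
    proof -
      have "inj_on (p g) T"
        using p_inj[OF face_carrier[OF g]] subT by (auto simp: inj_on_def)
      thus ?thesis
        using A(1) A(3)[OF g] stable_image[OF T g] inj_on_image_set_diff[of "p g" T T A]
        by (auto simp: B_def)
    qed
    have AT: "A \<subseteq> T" and BT: "B \<subseteq> T" using A B by auto
    have "stable A"
      unfolding stable_def using A(3) face_mono[OF AT] AT subT by blast
    moreover have "stable B"
      unfolding stable_def using pB face_mono[OF BT] BT subT by blast
    moreover have "card A < card T" "card B < card T"
      using A(1) B(1) finT by (simp_all add: psubset_card_mono)
    ultimately obtain xs ys where xs: "distinct xs" "set xs = A" "\<forall>g\<in>face A.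
        \<exists>m. range m \<subseteq> {0, 1::nat} \<and> g = list_mult G (map (\<lambda>s. s [^] m s) xs)"
      and ys: "distinct ys" "set ys = B" "\<forall>g\<in>face B.
        \<exists>m. range m \<subseteq> {0, 1::nat} \<and> g = list_mult G (map (\<lambda>s. s [^] m s) ys)"
      using less.hyps[of A] less.hyps[of B] by auto
    have "\<exists>m. range m \<subseteq> {0, 1::nat} \<and> g = list_mult G (map (\<lambda>s. s [^] m s) (xs @ ys))"
      if g: "g \<in> face T" for g
    proof -
      obtain h k where hk: "h \<in> face A" "k \<in> face B" "g = h \<otimes> k"
        using face_factor[of g A B] g B(2,3) AT BT subT pB face_mono[OF AT]
        by (auto simp: face_def subset_iff)
      obtain m where m: "range m \<subseteq> {0, 1::nat}" "h = list_mult G (map (\<lambda>s. s [^] m s) xs)"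
        using bspec[OF xs(3) hk(1)] by blast
      obtain m' where m': "range m' \<subseteq> {0, 1::nat}" "k = list_mult G (map (\<lambda>s. s [^] m' s) ys)"
        using bspec[OF ys(3) hk(2)] by blast
      define q where "q s = (if s \<in> A then m s else m' s)" for s
      have "map (\<lambda>s. s [^] q s) xs = map (\<lambda>s. s [^] m s) xs"
        using xs(2) by (simp add: q_def)
      moreover have "map (\<lambda>s. s [^] q s) ys = map (\<lambda>s. s [^] m' s) ys"
        using ys(2) B(3) by (auto simp: q_def)
      moreover have "list_mult G (map (\<lambda>s. s [^] q s) (xs @ ys)) =
          list_mult G (map (\<lambda>s. s [^] q s) xs) \<otimes> list_mult G (map (\<lambda>s. s [^] q s) ys)"
        unfolding map_append
        by (rule list_mult_append) (use xs(2) ys(2) A B subT S_carrier in auto)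
      ultimately have "g = list_mult G (map (\<lambda>s. s [^] q s) (xs @ ys))"
        using hk(3) m(2) m'(2) by (simp only:)
      moreover have "range q \<subseteq> {0, 1}" using m(1) m'(1) by (simp add: q_def image_subset_iff)
      ultimately show ?thesis by blast
    qed
    moreover have "distinct (xs @ ys)" "set (xs @ ys) = T" using xs ys B by auto
    ultimately show ?thesis by blast
  next
    case False
    \<comment> \<open>At most one direction is left: the face is a point or a single edge.\<close>
    then consider "T = {}" | t where "T = {t}" by blast
    thus ?thesis
    proof cases
      case 1
      have "g = \<one>" if "g \<in> face {}" for g
        using that f_inj[of g \<one>] f_one by (simp add: face_def)
      thus ?thesis using 1 by (auto simp: list_mult_def intro!: exI[of _ "\<lambda>_. 0"])
    next
      case 2
      hence t: "t \<in> S" using subT by simp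
      have "\<exists>m. range m \<subseteq> {0, 1::nat} \<and> g = list_mult G (map (\<lambda>s. s [^] m s) [t])"
        if g: "g \<in> face T" for g
      proof -
        have "f g = f \<one> \<or> f g = f t" using g 2 f_generator[OF t] by (auto simp: face_def f_one)
        hence "g = \<one> \<or> g = t" using f_inj g t face_carrier S_carrier by blast
        thus ?thesis
        proof
          assume "g = \<one>"
          thus ?thesis by (intro exI[of _ "\<lambda>_. 0"]) (auto simp: list_mult_def)
        next
          assume "g = t"
          thus ?thesis using S_carrier[OF t] by (intro exI[of _ "\<lambda>_. 1"]) (auto simp: list_mult_def)
        qed
      qed
      thus ?thesis using 2 by (intro exI[of _ "[t]"]) simp
    qed
  qed
qed

lemma face_S: "face S = carrier G"
  using f_subset by (auto simp: face_def)

lemma stable_S: "stable S"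
  using p_bij face_S by (auto simp: stable_def bij_betw_def)

end

section \<open>The labelling obtained from the hypercube isomorphism\<close>

lemma (in cube_group) hypercube_coordinates:
  obtains \<phi> where "bij_betw \<phi> (carrier G) ({1..n} \<rightarrow>\<^sub>E {0, 1::nat})"
    and "\<And>g h. g \<in> carrier G \<Longrightarrow> h \<in> carrier G \<Longrightarrow>
      (\<exists>s\<in>S. h = g \<otimes> s) \<longleftrightarrow> (\<exists>!i. i \<in> {1..n} \<and> \<phi> g i \<noteq> \<phi> h i)"
proof -
  define V where "V = {1..n} \<rightarrow>\<^sub>E {0, 1::nat}"
  define R where "R v w \<longleftrightarrow> (\<exists>!i. i \<in> {1..n} \<and> v i \<noteq> (w i :: nat))" for v w
  have H: "hypercube_graph n = \<lparr>pverts = V, parcs = {(v, w). v \<in> V \<and> w \<in> V \<and> R v w}\<rparr>"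
    by (simp add: hypercube_graph_def V_def R_def)
  have C: "pair_wf_digraph (cayley_graph G S)"
    by (auto simp: pair_wf_digraph_def cayley_graph_def)
  have "pair_wf_digraph (hypercube_graph n)"
    unfolding H by (auto simp: pair_wf_digraph_def)
  from digraph_iso_pair_iff[OF C this] cayley_graph_iso_hypercube
  obtain \<phi> where \<phi>: "bij_betw \<phi> (carrier G) V"
    and adj: "\<forall>g\<in>carrier G. \<forall>h\<in>carrier G.
      (g, h) \<in> parcs (cayley_graph G S) \<longleftrightarrow> (\<phi> g, \<phi> h) \<in> parcs (hypercube_graph n)"
    by (simp add: cayley_graph_def H) blast
  have "\<phi> g \<in> V" if "g \<in> carrier G" for g
    using bij_betw_apply[OF \<phi> that] .
  hence "(\<exists>s\<in>S. h = g \<otimes> s) \<longleftrightarrow> R (\<phi> g) (\<phi> h)"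
    if "g \<in> carrier G" "h \<in> carrier G" for g h
    using adj that by (simp add: cayley_graph_def H)
  with \<phi> show thesis unfolding V_def R_def by (rule that)
qed

lemma (in cube_group) involution: "s \<in> S \<Longrightarrow> s \<otimes> s = \<one>"
  using pow_ord_eq_1[of s] generators_closed generators_involutions
  by (auto simp: numeral_2_eq_2 subset_iff)

text \<open>Coordinates are read relative to the vertex of \<one>, and each is named by the
  generator whose edge at \<one> flips it; so the isomorphism may send \<one> to any vertex.\<close>

lemma (in cube_group) labelling_exists:
  "\<exists>f p. cube_labelling G S f p \<and> card S = n"
proof (rule hypercube_coordinates)
  fix \<phi>
  assume \<phi>': "bij_betw \<phi> (carrier G) ({1..n} \<rightarrow>\<^sub>E {0, 1::nat})"
    and adj: "\<And>g h. g \<in> carrier G \<Longrightarrow> h \<in> carrier G \<Longrightarrow>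
      (\<exists>s\<in>S. h = g \<otimes> s) \<longleftrightarrow> (\<exists>!i. i \<in> {1..n} \<and> \<phi> g i \<noteq> \<phi> h i)"
  define V where "V = {1..n} \<rightarrow>\<^sub>E {0, 1::nat}"
  note \<phi> = \<phi>'[folded V_def]
  note Sc = subsetD[OF generators_closed]
  have \<phi>V: "\<phi> g \<in> V" if "g \<in> carrier G" for g
    using \<phi> that by (auto simp: bij_betw_def)
  have bit: "\<phi> g i = 0 \<or> \<phi> g i = 1" if "g \<in> carrier G" "i \<in> {1..n}" for g i
    using PiE_mem[OF \<phi>V[OF that(1), unfolded V_def] that(2)] by simp
  have \<phi>eq: "g = h" if "g \<in> carrier G" "h \<in> carrier G" "\<And>i. i \<in> {1..n} \<Longrightarrow> \<phi> g i = \<phi> h i" for g h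
  proof -
    have "\<phi> g = \<phi> h"
      using \<phi>V[OF that(1)] \<phi>V[OF that(2)] that(3) unfolding V_def by (rule PiE_ext)
    thus ?thesis using \<phi> that by (auto simp: bij_betw_def dest: inj_onD)
  qed
  have \<phi>surj: "\<exists>g\<in>carrier G. \<phi> g = v" if "v \<in> V" for v
    using bij_betw_imp_surj_on[OF \<phi>] that by (metis imageE)
  define d where "d g s = (THE i. i \<in> {1..n} \<and> \<phi> g i \<noteq> \<phi> (g \<otimes> s) i)" for g s
  have d: "d g s \<in> {1..n} \<and> (\<forall>i\<in>{1..n}. \<phi> (g \<otimes> s) i \<noteq> \<phi> g i \<longleftrightarrow> i = d g s)"
    if "g \<in> carrier G" "s \<in> S" for g s
  proof -
    have ex1: "\<exists>!i. i \<in> {1..n} \<and> \<phi> g i \<noteq> \<phi> (g \<otimes> s) i"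
      using adj[of g "g \<otimes> s"] that Sc by auto
    from theI'[OF ex1] show ?thesis
      using ex1 unfolding d_def[symmetric] by metis
  qed
  have d_bij: "bij_betw (d g) S {1..n}" if g: "g \<in> carrier G" for g
  proof (rule bij_betw_imageI)
    show "inj_on (d g) S"
    proof (rule inj_onI)
      fix s t assume st: "s \<in> S" "t \<in> S" "d g s = d g t"
      have "g \<otimes> s = g \<otimes> t"
      proof (rule \<phi>eq)
        fix i assume i: "i \<in> {1..n}"
        show "\<phi> (g \<otimes> s) i = \<phi> (g \<otimes> t) i"
        proof (cases "i = d g s")
          case True
          have "g \<otimes> s \<in> carrier G" "g \<otimes> t \<in> carrier G" using g st Sc by auto
          moreover have "\<phi> (g \<otimes> s) i \<noteq> \<phi> g i" "\<phi> (g \<otimes> t) i \<noteq> \<phi> g i"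
            using d[OF g st(1)] d[OF g st(2)] st(3) i True by auto
          ultimately show ?thesis using bit[OF _ i, of g] bit[OF _ i, of "g \<otimes> s"]
              bit[OF _ i, of "g \<otimes> t"] g by auto
        next
          case False
          have "\<phi> (g \<otimes> s) i = \<phi> g i" "\<phi> (g \<otimes> t) i = \<phi> g i"
            using d[OF g st(1)] d[OF g st(2)] st(3) i False by auto
          thus ?thesis by simp
        qed
      qed (use g st Sc in auto)
      thus "s = t" using g st Sc by simp
    qed
    have "i \<in> d g ` S" if i: "i \<in> {1..n}" for i
    proof -
      \<comment> \<open>On bits \<open>1 -\<close> is the flip; the flipped vertex is a neighbour of
        \<open>g\<close>, which supplies the generator.\<close>
      have "(\<phi> g)(i := 1 - \<phi> g i) \<in> V"
        using \<phi>V[OF g] i bit[OF g i] by (auto simp: V_def PiE_iff extensional_def)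
      then obtain h where h: "h \<in> carrier G" "\<phi> h = (\<phi> g)(i := 1 - \<phi> g i)"
        using \<phi>surj by blast
      have ne: "\<phi> g j \<noteq> \<phi> h j \<longleftrightarrow> j = i" if "j \<in> {1..n}" for j
        using h bit[OF g i] by auto
      hence "\<exists>!j. j \<in> {1..n} \<and> \<phi> g j \<noteq> \<phi> h j" using i by blast
      then obtain s where s: "s \<in> S" "h = g \<otimes> s" using adj[OF g h(1)] by blast
      hence "d g s = i" using d[OF g s(1)] ne i by metis
      thus ?thesis using s by blast
    qed
    thus "d g ` S = {1..n}" using d[OF g] by blast
  qed
  \<comment> \<open>\<open>e\<close> is the dictionary from generators to coordinates;
    \<open>f\<close> and \<open>p\<close> are \<phi> and \<open>d\<close> translated through
    it.\<close>
  define e where "e = d \<one>"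
  have e: "bij_betw e S {1..n}" unfolding e_def using d_bij by simp
  have e_in: "e s \<in> {1..n}" if "s \<in> S" for s using e that by (auto simp: bij_betw_def)
  have e_surj: "\<exists>s\<in>S. e s = i" if "i \<in> {1..n}" for i
    using bij_betw_imp_surj_on[OF e] that by (metis imageE)
  define f where "f g = {s \<in> S. \<phi> g (e s) \<noteq> \<phi> \<one> (e s)}" for g
  define p where "p g s = inv_into S e (d g s)" for g s
  have ep: "e (p g s) = d g s \<and> p g s \<in> S" if "g \<in> carrier G" "s \<in> S" for g s
    using d[OF that] e unfolding p_def bij_betw_def by (metis f_inv_into_f inv_into_into)
  have "cube_labelling G S f p"
  proof
    show "finite S" using e bij_betw_finite by blast
    show "bij_betw f (carrier G) (Pow S)"
    proof (rule bij_betw_imageI)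
      show "inj_on f (carrier G)"
      proof (rule inj_onI)
        fix g h assume gh: "g \<in> carrier G" "h \<in> carrier G" "f g = f h"
        show "g = h"
        proof (rule \<phi>eq[OF gh(1,2)])
          fix i assume i: "i \<in> {1..n}"
          obtain s where "s \<in> S" "e s = i" using e_surj[OF i] by blast
          hence "\<phi> g i \<noteq> \<phi> \<one> i \<longleftrightarrow> \<phi> h i \<noteq> \<phi> \<one> i" using gh(3) by (auto simp: f_def)
          thus "\<phi> g i = \<phi> h i"
            using bit[OF gh(1) i] bit[OF gh(2) i] bit[OF one_closed i] by metis
        qed
      qed
      have "Y \<in> f ` carrier G" if Y: "Y \<subseteq> S" for Y
      proof -
        \<comment> \<open>Flipping the coordinates named by \<open>Y\<close>, starting at the vertex
          of \<one>, realises \<open>Y\<close>; the restriction to \<open>{1..n}\<close> keeps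
          \<open>v\<close> extensional.\<close>
        define v where
          "v = (\<lambda>i\<in>{1..n}. if i \<in> e ` Y then 1 - \<phi> \<one> i else \<phi> \<one> i)"
        have "v i \<in> {0, 1}" if "i \<in> {1..n}" for i
          using bit[OF one_closed that] that by (auto simp: v_def)
        hence "v \<in> V" by (simp add: v_def V_def)
        then obtain g where g: "g \<in> carrier G" "\<phi> g = v" using \<phi>surj by blast
        have "s \<in> f g \<longleftrightarrow> s \<in> Y" if s: "s \<in> S" for s
        proof -
          have "e s \<in> e ` Y \<longleftrightarrow> s \<in> Y"
            using e Y s by (auto simp: bij_betw_def dest: inj_onD)
          thus ?thesis using s e_in[OF s] bit[OF one_closed e_in[OF s]] g
            by (auto simp: f_def v_def)
        qed
        moreover have "f g \<subseteq> S" by (auto simp: f_def)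
        ultimately have "f g = Y" using Y by blast
        thus ?thesis using g by blast
      qed
      thus "f ` carrier G = Pow S" by (auto simp: f_def)
    qed
    show "bij_betw (p g) S S" if "g \<in> carrier G" for g
      using bij_betw_trans[OF d_bij[OF that] bij_betw_inv_into[OF e]]
      by (simp add: p_def comp_def cong: bij_betw_cong)
    show "p \<one> s = s" if "s \<in> S" for s
      using e that by (simp add: p_def e_def[symmetric] bij_betw_def)
    show "f (g \<otimes> s) = sym_diff (f g) {p g s}" if gs: "g \<in> carrier G" "s \<in> S" for g s
    proof -
      \<comment> \<open>As bits have two values, disagreement with \<one> at \<open>e t\<close> is
        toggled exactly when that bit changes, that is, when \<open>e t = d g s\<close>.\<close>
      have "t \<in> f (g \<otimes> s) \<longleftrightarrow> t \<in> sym_diff (f g) {p g s}" if t: "t \<in> S" for t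
      proof -
        have "e t = d g s \<longleftrightarrow> t = p g s"
          using ep[OF gs] inj_onD[OF bij_betw_imp_inj_on[OF e], of t "p g s"] t by auto
        moreover have "\<phi> (g \<otimes> s) (e t) \<noteq> \<phi> g (e t) \<longleftrightarrow> e t = d g s"
          using d[OF gs] e_in[OF t] by blast
        moreover have "g \<otimes> s \<in> carrier G" using gs Sc by simp
        ultimately show ?thesis
          using t bit[OF _ e_in[OF t], of g] bit[OF _ e_in[OF t], of "g \<otimes> s"]
            bit[OF _ e_in[OF t], of \<one>] gs(1) by (auto simp: f_def)
      qed
      thus ?thesis using ep[OF gs] by (fastforce simp: f_def)
    qed
  qed (use generators_closed involution in \<open>auto simp: f_def\<close>)
  moreover have "card S = n" using bij_betw_same_card[OF e] by simp
  ultimately show ?thesis by blast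
qed

section \<open>Indexing the ordering and counting exponent vectors\<close>

lemma listset_iff: "xs \<in> listset As \<longleftrightarrow> list_all2 (\<in>) xs As"
  by (induction As arbitrary: xs) (auto simp: set_Cons_def list_all2_Cons2)

theorem mainTheorem1:
  fixes G (structure) and S :: "'a set" and n :: nat
  assumes "cube_group G S n"
  shows "\<exists>s :: nat \<Rightarrow> 'a.
    bij_betw s {1..n} S \<and>
    carrier G = list_set_mult G (map (\<lambda>i. generate G {s i}) [1..<Suc n]) \<and>
    (\<forall>g \<in> carrier G. \<exists>!m :: nat \<Rightarrow> nat. m \<in> {1..n} \<rightarrow>\<^sub>E {0, 1} \<and>
        g = list_mult G (map (\<lambda>i. s i [^] m i) [1..<Suc n]))"
proof -
  interpret cube_group G S n by fact
  obtain f p where "cube_labelling G S f p" and n: "card S = n"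
    using labelling_exists by blast
  then interpret cube_labelling G S f p by simp
  obtain xs where xs: "distinct xs" "set xs = S"
    and prod: "\<And>g. g \<in> carrier G \<Longrightarrow>
      \<exists>m. range m \<subseteq> {0, 1::nat} \<and> g = list_mult G (map (\<lambda>s. s [^] m s) xs)"
    using face_eq_product[OF stable_S] face_S by auto
  have len: "length xs = n" using xs n distinct_card by metis
  \<comment> \<open>List positions start at 0, the required indices at 1.\<close>
  define s where "s i = xs ! (i - 1)" for i
  have map_s: "map F xs = map (\<lambda>i. F (s i)) [1..<Suc n]" for F :: "'a \<Rightarrow> 'c"
    by (rule nth_equalityI) (auto simp: len s_def simp del: upt_Suc)
  have "bij_betw (\<lambda>i. i - 1) {1..n} {..<n}"
    by (rule bij_betw_byWitness[where f' = Suc]) auto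
  from bij_betw_trans[OF this bij_betw_nth[OF xs(1)]]
  have s: "bij_betw s {1..n} S" using len xs(2) by (simp add: s_def[abs_def] comp_def)
  have s_inj: "s i = s j \<longleftrightarrow> i = j" if "i \<in> {1..n}" "j \<in> {1..n}" for i j
    using s that by (auto simp: bij_betw_def dest: inj_onD)
  have sc: "s i \<in> carrier G" if "i \<in> {1..n}" for i
    using s that S_carrier by (auto simp: bij_betw_def)
  have mult_closed: "list_mult G ys \<in> carrier G" if "set ys \<subseteq> carrier G" for ys
    using list_mult_append(2)[OF that, of "[]"] by simp
  have carrier: "carrier G = list_set_mult G (map (\<lambda>i. generate G {s i}) [1..<Suc n])"
  proof (intro equalityI subsetI)
    fix g assume "g \<in> carrier G"
    then obtain m :: "'a \<Rightarrow> nat" where m: "g = list_mult G (map (\<lambda>s. s [^] m s) xs)"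
      using prod by blast
    \<comment> \<open>\<open>generate_pow\<close> describes the cyclic subgroup by integer
      exponents, so the natural power is read as an integer one.\<close>
    have "s i [^] k \<in> generate G {s i}" if "i \<in> {1..n}" for i and k :: nat
      using generate_pow[OF sc[OF that]] int_pow_int[of G "s i" k] by (metis (mono_tags, lifting) UNIV_I mem_Collect_eq)
    hence "map (\<lambda>i. s i [^] m (s i)) [1..<Suc n] \<in> listset (map (\<lambda>i. generate G {s i}) [1..<Suc n])"
      by (auto simp: listset_iff list_all2_conv_all_nth simp del: upt_Suc)
    thus "g \<in> list_set_mult G (map (\<lambda>i. generate G {s i}) [1..<Suc n])"
      unfolding m map_s list_set_mult_def by blast
  next
    fix g assume "g \<in> list_set_mult G (map (\<lambda>i. generate G {s i}) [1..<Suc n])"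
    then obtain hs where hs: "g = list_mult G hs"
      "list_all2 (\<in>) hs (map (\<lambda>i. generate G {s i}) [1..<Suc n])"
      by (auto simp: list_set_mult_def listset_iff simp del: upt_Suc)
    have "hs ! j \<in> carrier G" if "j < length hs" for j
    proof -
      have j: "j < n" using that hs(2) by (simp add: list_all2_conv_all_nth del: upt_Suc)
      hence "hs ! j \<in> generate G {s (Suc j)}"
        using list_all2_nthD[OF hs(2) that] by (simp del: upt_Suc)
      thus ?thesis using generate_incl[of "{s (Suc j)}"] sc[of "Suc j"] j by auto
    qed
    hence "set hs \<subseteq> carrier G" by (auto simp: in_set_conv_nth)
    thus "g \<in> carrier G" using hs mult_closed by simp
  qed
  define F where "F m = list_mult G (map (\<lambda>i. s i [^] m i) [1..<Suc n])" for m :: "nat \<Rightarrow> nat"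
  define V where "V = {1..n} \<rightarrow>\<^sub>E {0, 1::nat}"
  have F_surj: "F ` V = carrier G"
  proof (intro equalityI subsetI)
    fix g assume "g \<in> F ` V"
    thus "g \<in> carrier G" unfolding F_def using sc by (auto intro!: mult_closed simp del: upt_Suc)
  next
    fix g assume "g \<in> carrier G"
    then obtain m where m: "range m \<subseteq> {0, 1::nat}" "g = list_mult G (map (\<lambda>s. s [^] m s) xs)"
      using prod by blast
    \<comment> \<open>Exponents attached to generators become exponents attached to indices, cut
      down to \<open>{1..n}\<close> so as to lie in \<open>V\<close>.\<close>
    have "F (\<lambda>i\<in>{1..n}. m (s i)) = g"
      unfolding F_def m(2) map_s by (intro arg_cong[where f = "list_mult G"] map_cong) auto
    moreover have "(\<lambda>i\<in>{1..n}. m (s i)) \<in> V" using m(1) by (simp add: V_def image_subset_iff)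
    ultimately show "g \<in> F ` V" by blast
  qed
  \<comment> \<open>Uniqueness is injectivity of \<open>F\<close> on \<open>V\<close>: a surjection
    between finite sets of equal size is injective.\<close>
  have "card (carrier G) = 2 ^ n" using card_face[of S] face_S n by simp
  moreover have "card V = 2 ^ n" by (simp add: V_def card_PiE numeral_2_eq_2)
  moreover have "finite V" by (auto simp: V_def intro: finite_PiE)
  ultimately have "inj_on F V"
    using F_surj by (intro eq_card_imp_inj_on) auto
  hence "\<exists>!m. m \<in> V \<and> g = F m" if "g \<in> carrier G" for g
    using F_surj that by (auto dest: inj_onD)
  thus ?thesis using s carrier unfolding F_def V_def by blast
qed

end
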